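(* Let $F$ be any tree with leaf set $W$, and let $T$ be a hub tree (a tree with leaf set $W$) with edge capacities $b:E(T)\to\mathbb{R}_+$. Define $q^*:E(F)\to\mathbb{R}_+$ by $$q^*(e)=\max_{D\in\mathcal{U}(T^b)}\sum_{\{i,j\}\in\Delta_F(e)} D_{ij},$$ where $\Delta_F(e)$ is the set of unordered pairs of leaves of $F$ separated by the edge $e$ (i.e. lying in different components of $F-e$). Then there is a $T$-hubbing for $\mathcal{U}(T^b)$ into $F$ with capacity allocation $q^*$.
   Context: Demands are symmetric vectors $D\in\mathbb{R}_+^{\binom{W}{2}}$ indexed by unordered pairs of terminals. For $\{i,j\}\subseteq W$ let $T_{ij}$ be the unique $i$-$j$ path in $T$. $\mathcal{U}(T^b)$ is the set of all $D\in\mathbb{R}_+^{\binom{W}{2}}$ with $\sum_{\{i,j\}: f\in T_{ij}} D_{ij}\le b(f)$ for every $f\in E(T)$. A $T$-embedding into a graph $G$ (here $G=F$, with terminals $W$) is a map $\phi$ assigning to each $v\in V(T)$ a vertex $\phi(v)\in V(G)$, with $\phi(i)=i$ for all $i\in W$, and to each edge $vw\in E(T)$ a simple $\phi(v)$-$\phi(w)$ path $\phi(vw)$ in $G$. For a convex universe $\mathcal{U}$, a $T$-hubbing for $\mathcal{U}$ into $G$ is a pair $(\phi,u)$ with $\phi$ a $T$-embedding and $u:E(G)\to\mathbb{R}_+$ satisfying $u(e)\ge\sum_{f\in E(T):\, e\in\phi(f)}\beta(f)$ for every $e\in E(G)$, where $\beta(f)=\max_{D\in\mathcal{U}}\sum_{\{i,j\}:\,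 f\in T_{ij}} D_{ij}$. "With capacity allocation $q^*$" means $(\phi,q^* )$ is such a pair. *)

theory Defs
  imports Main "HOL-Library.Extended_Real"
begin

definition graph :: "'a set \<Rightarrow> 'a set set \<Rightarrow> bool" where
  "graph V E \<longleftrightarrow> finite V \<and> (\<forall>e\<in>E. e \<subseteq> V \<and> card e = 2)"

definition is_path :: "'a set set \<Rightarrow> 'a list \<Rightarrow> 'a \<Rightarrow> 'a \<Rightarrow> bool" where
  "is_path E xs u v \<longleftrightarrow> xs \<noteq> [] \<and> hd xs = u \<and> last xs = v \<and> distinct xs \<and>
     (\<forall>k. Suc k < length xs \<longrightarrow> {xs ! k, xs ! Suc k} \<in> E)"

definition path_edges :: "'a list \<Rightarrow> 'a set set" where
  "path_edges xs = {{xs ! k, xs ! Suc k} | k. Suc k < length xs}"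

definition is_cycle :: "'a set set \<Rightarrow> 'a list \<Rightarrow> bool" where
  "is_cycle E xs \<longleftrightarrow> length xs \<ge> 3 \<and> distinct xs \<and>
     (\<forall>k. Suc k < length xs \<longrightarrow> {xs ! k, xs ! Suc k} \<in> E) \<and> {last xs, hd xs} \<in> E"

definition connected_graph :: "'a set \<Rightarrow> 'a set set \<Rightarrow> bool" where
  "connected_graph V E \<longleftrightarrow> (\<forall>u\<in>V. \<forall>v\<in>V. \<exists>xs. is_path E xs u v)"

definition is_tree :: "'a set \<Rightarrow> 'a set set \<Rightarrow> bool" where
  "is_tree V E \<longleftrightarrow> graph V E \<and> V \<noteq> {} \<and> connected_graph V E \<and> (\<nexists>xs. is_cycle E xs)"

definition degree :: "'a set set \<Rightarrow> 'a \<Rightarrow> nat" where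
  "degree E v = card {e\<in>E. v \<in> e}"

definition leaves :: "'a set \<Rightarrow> 'a set set \<Rightarrow> 'a set" where
  "leaves V E = {v\<in>V. degree E v = 1}"

definition tree_path :: "'a set set \<Rightarrow> 'a \<Rightarrow> 'a \<Rightarrow> 'a list" where
  "tree_path E i j = (THE xs. is_path E xs i j)"

definition upairs :: "'a set \<Rightarrow> 'a set set" where
  "upairs W = {{i, j} | i j. i \<in> W \<and> j \<in> W \<and> i \<noteq> j}"

definition tree_load :: "'a set set \<Rightarrow> 'a set \<Rightarrow> ('a set \<Rightarrow> real) \<Rightarrow> 'a set \<Rightarrow> real" where
  "tree_load ET W D f =
     (\<Sum>p\<in>{p\<in>upairs W. \<exists>i j. p = {i, j} \<and> f \<in> path_edges (tree_path ET i j)}. D p)"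

text \<open>The universe U(T^b): nonnegative demand vectors on the pairs of W (zero
  outside them, so they are vectors indexed by the pairs) respecting capacities.\<close>

definition universe :: "'a set set \<Rightarrow> 'a set \<Rightarrow> ('a set \<Rightarrow> real) \<Rightarrow> ('a set \<Rightarrow> real) set" where
  "universe ET W b = {D. (\<forall>p\<in>upairs W. D p \<ge> 0) \<and> (\<forall>p. p \<notin> upairs W \<longrightarrow> D p = 0) \<and>
      (\<forall>f\<in>ET. tree_load ET W D f \<le> b f)}"

text \<open>beta(f): maximum over the universe of the load on f (the universe is compact and
  nonempty, so the supremum is attained).\<close>

definition beta :: "'a set set \<Rightarrow> 'a set \<Rightarrow> ('a set \<Rightarrow> real) \<Rightarrow> 'a set \<Rightarrow> real" where
  "beta ET W b f = (SUP D\<in>universe ET W b. tree_load ET W D f)"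

definition separated :: "'a set set \<Rightarrow> 'a set \<Rightarrow> 'a \<Rightarrow> 'a \<Rightarrow> bool" where
  "separated E e i j \<longleftrightarrow> \<not> (\<exists>xs. is_path (E - {e}) xs i j)"

definition Delta :: "'a set set \<Rightarrow> 'a set \<Rightarrow> 'a set \<Rightarrow> 'a set set" where
  "Delta EF W e = {p\<in>upairs W. \<exists>i j. p = {i, j} \<and> separated EF e i j}"

definition qstar :: "'a set set \<Rightarrow> 'a set \<Rightarrow> 'a set set \<Rightarrow> ('a set \<Rightarrow> real) \<Rightarrow> 'a set \<Rightarrow> real" where
  "qstar EF W ET b e = (SUP D\<in>universe ET W b. \<Sum>p\<in>Delta EF W e. D p)"

definition T_embedding ::
  "'a set \<Rightarrow> 'a set set \<Rightarrow> 'a set \<Rightarrow> 'a set set \<Rightarrow> 'a set \<Rightarrow> ('a \<Rightarrow> 'a) \<Rightarrow> ('a set \<Rightarrow> 'a list) \<Rightarrow> bool" where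
  "T_embedding VT ET VG EG W phiV phiE \<longleftrightarrow>
     (\<forall>v\<in>VT. phiV v \<in> VG) \<and> (\<forall>i\<in>W. phiV i = i) \<and>
     (\<forall>v w. {v, w} \<in> ET \<longrightarrow>
        is_path EG (phiE {v, w}) (phiV v) (phiV w) \<or> is_path EG (phiE {v, w}) (phiV w) (phiV v))"

definition T_hubbing ::
  "'a set \<Rightarrow> 'a set set \<Rightarrow> ('a set \<Rightarrow> real) \<Rightarrow> 'a set \<Rightarrow> 'a set set \<Rightarrow> 'a set
     \<Rightarrow> ('a \<Rightarrow> 'a) \<Rightarrow> ('a set \<Rightarrow> 'a list) \<Rightarrow> ('a set \<Rightarrow> real) \<Rightarrow> bool" where
  "T_hubbing VT ET b VG EG W phiV phiE u \<longleftrightarrow>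
     T_embedding VT ET VG EG W phiV phiE \<and>
     (\<forall>e\<in>EG. u e \<ge> 0 \<and>
        u e \<ge> (\<Sum>f\<in>{f\<in>ET. e \<in> path_edges (phiE f)}. beta ET W b f))"

end

(* Root F at r. For an edge e of F let A(e) be the set of leaves that e separates from r, and
let S(e) be the inclusion-minimal vertex set of T that contains A(e), misses the other leaves and
has the least boundary capacity. Submodularity gives S(e) <= S(e') whenever A(e) <= A(e'), and
posimodularity makes S(e), S(e') disjoint whenever A(e), A(e') are. Hence for a vertex v of T the
prescriptions "e separates r from x iff v lies in S(e)" are pairwise compatible, and by the Helly
property of trees exactly one vertex x = phi(v) of F fulfils all of them. The image of an edge f of
T then uses e iff f lies on the boundary of S(e), so the capacity required at e is at most that of
S(e), which is at most q*(e) by max-flow min-cut for T with the source leaves A(e). *)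

theory Submission
  imports Defs "HOL-Analysis.Function_Topology"
begin

section \<open>Connectivity, paths and separation by an edge\<close>

text \<open>Taking the reflexive transitive closure makes transitivity and symmetry immediate,
  whereas concatenating two instances of \<open>is_path\<close> may repeat vertices.\<close>

definition conn :: "'a set set \<Rightarrow> 'a \<Rightarrow> 'a \<Rightarrow> bool" where
  "conn E x y \<longleftrightarrow> (x, y) \<in> {(x, y). {x, y} \<in> E}\<^sup>*"

lemma conn_refl [simp]: "conn E x x"
  by (simp add: conn_def)

lemma conn_trans: "conn E x y \<Longrightarrow> conn E y z \<Longrightarrow> conn E x z"
  by (simp add: conn_def)

lemma conn_edge: "{x, y} \<in> E \<Longrightarrow> conn E x y"
  by (auto simp: conn_def)

lemma conn_sym: "conn E x y \<Longrightarrow> conn E y x"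
proof -
  have "sym {(x, y). {x, y} \<in> E}"
    by (auto simp: sym_def insert_commute)
  then show "conn E x y \<Longrightarrow> conn E y x"
    by (auto simp: conn_def dest: sym_rtrancl symD)
qed

lemma path_edges_Nil [simp]: "path_edges [] = {}"
  by (simp add: path_edges_def)

lemma path_edges_Cons:
  "path_edges (x # xs) = (if xs = [] then {} else insert {x, hd xs} (path_edges xs))"
proof (cases xs)
  case (Cons y ys)
  have "path_edges (x # y # ys) = insert {x, y} (path_edges (y # ys))" (is "?L = ?R")
  proof
    show "?L \<subseteq> ?R"
    proof
      fix f assume "f \<in> ?L"
      then obtain k where k: "f = {(x # y # ys) ! k, (x # y # ys) ! Suc k}"
        "Suc k < length (x # y # ys)"
        by (auto simp: path_edges_def)
      then show "f \<in> ?R"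
        by (cases k) (auto simp: path_edges_def)
    qed
    have "{(y # ys) ! k, (y # ys) ! Suc k} \<in> ?L" if "Suc k < length (y # ys)" for k
      unfolding path_edges_def using that by (intro CollectI exI[of _ "Suc k"]) simp
    moreover have "{x, y} \<in> ?L"
      unfolding path_edges_def by (intro CollectI exI[of _ 0]) simp
    ultimately show "?R \<subseteq> ?L"
      unfolding path_edges_def[of "y # ys"] by blast
  qed
  then show ?thesis using Cons by simp
qed (auto simp: path_edges_def)

lemma path_edges_append:
  assumes "xs \<noteq> []" "ys \<noteq> []"
  shows "path_edges (xs @ ys) = insert {last xs, hd ys} (path_edges xs \<union> path_edges ys)"
  using assms(1)
proof (induction xs)
  case (Cons x xs)
  then show ?case using assms(2)
    by (cases "xs = []") (auto simp: path_edges_Cons)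
qed simp

lemma path_edges_subset: "f \<in> path_edges xs \<Longrightarrow> f \<subseteq> set xs"
  by (induction xs) (auto simp: path_edges_Cons split: if_splits)

lemma path_edges_split:
  assumes "f \<in> path_edges xs"
  obtains ys zs where "xs = ys @ zs" "ys \<noteq> []" "zs \<noteq> []" "f = {last ys, hd zs}"
proof -
  obtain k where k: "f = {xs ! k, xs ! Suc k}" "Suc k < length xs"
    using assms by (auto simp: path_edges_def)
  show ?thesis
  proof (rule that[of "take (Suc k) xs" "drop (Suc k) xs"])
    have "last (take (Suc k) xs) = xs ! k"
      using k by (subst last_conv_nth) (auto simp: min_def)
    then show "f = {last (take (Suc k) xs), hd (drop (Suc k) xs)}"
      using k by (simp add: hd_drop_conv_nth)
  qed (use k in auto)
qed

lemma is_path_iff: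
  "is_path E xs u v \<longleftrightarrow>
     xs \<noteq> [] \<and> hd xs = u \<and> last xs = v \<and> distinct xs \<and> path_edges xs \<subseteq> E"
  by (auto simp: is_path_def path_edges_def)

lemma is_path_append:
  assumes "xs \<noteq> []" "ys \<noteq> []"
  shows "is_path E (xs @ ys) u v \<longleftrightarrow> is_path E xs u (last xs) \<and> is_path E ys (hd ys) v \<and>
     {last xs, hd ys} \<in> E \<and> set xs \<inter> set ys = {}"
  using assms by (auto simp: is_path_iff path_edges_append)

text \<open>When a path is extended at the front by a vertex \<open>x\<close> that already lies on
  it, the suffix starting at \<open>x\<close> is a path instead, so distinctness is kept.\<close>

lemma conn_iff_path: "conn E x y \<longleftrightarrow> (\<exists>xs. is_path E xs x y)"
proof
  assume "conn E x y"
  then show "\<exists>xs. is_path E xs x y"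
    unfolding conn_def
  proof (induction rule: converse_rtrancl_induct)
    case base
    have "is_path E [y] y y" by (simp add: is_path_def)
    then show ?case ..
  next
    case (step x z)
    then obtain xs where xs: "is_path E xs z y" by blast
    show ?case
    proof (cases "x \<in> set xs")
      case True
      then obtain ys zs where s: "xs = ys @ x # zs" by (meson split_list)
      have "is_path E (x # zs) x y"
        using xs s by (cases "ys = []") (auto simp: is_path_append is_path_iff path_edges_append)
      then show ?thesis by blast
    next
      case False
      then have "is_path E (x # xs) x y"
        using xs step(1) by (auto simp: is_path_iff path_edges_Cons)
      then show ?thesis by blast
    qed
  qed
next
  assume "\<exists>xs. is_path E xs x y"
  then obtain xs where "is_path E xs x y" by blast
  then show "conn E x y"
  proof (induction xs arbitrary: x)
    case (Cons a xs)
    show ?case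
    proof (cases "xs = []")
      case False
      then have "is_path E xs (hd xs) y" "{x, hd xs} \<in> E"
        using Cons.prems by (auto simp: is_path_iff path_edges_Cons)
      then show ?thesis
        using Cons.IH conn_edge conn_trans by metis
    qed (use Cons.prems in \<open>auto simp: is_path_iff\<close>)
  qed (simp add: is_path_def)
qed

lemma separated_iff: "separated E e x y \<longleftrightarrow> \<not> conn (E - {e}) x y"
  by (simp add: separated_def conn_iff_path)

lemma separated_sym: "separated E e x y \<longleftrightarrow> separated E e y x"
  using conn_sym by (auto simp: separated_iff)

lemma separated_triangle: "separated E e x z \<Longrightarrow> separated E e x y \<or> separated E e y z"
  unfolding separated_iff using conn_trans by metis

lemma not_separated_refl [simp]: "\<not> separated E e x x"
  by (simp add: separated_iff)

lemma not_separated_pathI: "is_path E xs x y \<Longrightarrow> e \<notin> path_edges xs \<Longrightarrow> \<not> separated E e x y"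
  unfolding separated_def by (auto simp: is_path_iff)

lemma not_separated_edge: "{x, y} \<in> E \<Longrightarrow> {x, y} \<noteq> e \<Longrightarrow> \<not> separated E e x y"
  by (simp add: separated_iff conn_edge)

text \<open>By distinctness each half misses one end of the connecting edge, so neither half uses
  that edge.\<close>

lemma path_split_not_separated:
  assumes p: "is_path E (xs @ ys) u v" and ne: "xs \<noteq> []" "ys \<noteq> []"
  shows "\<not> separated E {last xs, hd ys} u (last xs)" "\<not> separated E {last xs, hd ys} (hd ys) v"
proof -
  have d: "is_path E xs u (last xs)" "is_path E ys (hd ys) v" "set xs \<inter> set ys = {}"
    using p ne by (auto simp: is_path_append)
  have "hd ys \<notin> set xs" "last xs \<notin> set ys"
    using hd_in_set[OF ne(2)] last_in_set[OF ne(1)] d(3) by auto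
  then have "{last xs, hd ys} \<notin> path_edges xs" "{last xs, hd ys} \<notin> path_edges ys"
    using path_edges_subset by (metis insert_subset)+
  then show "\<not> separated E {last xs, hd ys} u (last xs)"
    "\<not> separated E {last xs, hd ys} (hd ys) v"
    using not_separated_pathI[OF d(1)] not_separated_pathI[OF d(2)] by simp_all
qed

section \<open>Trees: unique paths, the two sides of an edge, and the Helly property\<close>

context
  fixes V :: "'a set" and E :: "'a set set"
  assumes tree: "is_tree V E"
begin

lemma edge_card: "e \<in> E \<Longrightarrow> card e = 2" and edge_subset: "e \<in> E \<Longrightarrow> e \<subseteq> V"
  and finite_V: "finite V" and finite_E: "finite E"
proof -
  have g: "finite V" "\<forall>e\<in>E. e \<subseteq> V \<and> card e = 2"
    using tree by (auto simp: is_tree_def graph_def)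
  then show "finite V" "e \<in> E \<Longrightarrow> card e = 2" "e \<in> E \<Longrightarrow> e \<subseteq> V" by auto
  have "E \<subseteq> Pow V" using g by blast
  then show "finite E" using g(1) finite_subset by blast
qed

lemma tree_path_exists: "x \<in> V \<Longrightarrow> y \<in> V \<Longrightarrow> \<exists>xs. is_path E xs x y"
  using tree by (auto simp: is_tree_def connected_graph_def)

text \<open>A path from \<open>u\<close> to \<open>v\<close> that avoids the edge has an inner
  vertex, so the edge would close it to a cycle.\<close>

lemma edge_separates:
  assumes e: "{u, v} \<in> E"
  shows "separated E {u, v} u v"
  unfolding separated_def
proof
  assume "\<exists>xs. is_path (E - {{u, v}}) xs u v"
  then obtain xs where xs: "is_path (E - {{u, v}}) xs u v" ..
  have "u \<noteq> v" using edge_card[OF e] by auto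
  have "length xs \<ge> 3"
  proof (cases xs)
    case (Cons a ys)
    show ?thesis
    proof (cases ys)
      case (Cons c zs)
      then show ?thesis
        using xs \<open>xs = a # ys\<close> by (cases zs) (auto simp: is_path_iff path_edges_Cons)
    qed (use xs Cons \<open>u \<noteq> v\<close> in \<open>auto simp: is_path_iff\<close>)
  qed (use xs in \<open>simp add: is_path_iff\<close>)
  then have "is_cycle E xs"
    using xs e unfolding is_cycle_def is_path_def by (simp add: insert_commute)
  then show False using tree by (auto simp: is_tree_def)
qed

text \<open>If \<open>f\<close> is on the path, the two remaining parts tie \<open>x\<close> and
  \<open>y\<close> to opposite ends of \<open>f\<close>, which \<open>f\<close> separates. The edge
  set of a path is thus determined by its ends alone.\<close>

lemma path_edges_iff_separated:
  assumes xs: "is_path E xs x y"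
  shows "f \<in> path_edges xs \<longleftrightarrow> f \<in> E \<and> separated E f x y"
proof
  assume f: "f \<in> path_edges xs"
  then have fE: "f \<in> E" using xs by (auto simp: is_path_iff)
  obtain ys zs where s: "xs = ys @ zs" "ys \<noteq> []" "zs \<noteq> []" "f = {last ys, hd zs}"
    using path_edges_split[OF f] .
  have "\<not> separated E f x (last ys)" "\<not> separated E f (hd zs) y"
    using path_split_not_separated xs s by metis+
  moreover have "separated E f (last ys) (hd zs)"
    using edge_separates fE s by simp
  ultimately show "f \<in> E \<and> separated E f x y"
    using fE separated_triangle[of E f "last ys" "hd zs" x] separated_triangle[of E f x "hd zs" y]
      separated_sym[of E f] by blast
next
  assume "f \<in> E \<and> separated E f x y"
  then show "f \<in> path_edges xs" using not_separated_pathI[OF xs] by auto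
qed

text \<open>Both paths have the same edges, and \<open>x\<close> lies on only one of them because it
  does not recur. Hence the second vertices agree and induction applies to the tails.\<close>

lemma path_unique:
  "is_path E xs x y \<Longrightarrow> is_path E ys x y \<Longrightarrow> xs = ys"
proof (induction xs arbitrary: x ys)
  case (Cons a xs)
  then have a: "a = x" by (simp add: is_path_iff)
  obtain ys' where ys: "ys = x # ys'"
    using Cons.prems by (cases ys) (auto simp: is_path_iff)
  have e: "path_edges (x # xs) = path_edges (x # ys')"
    using path_edges_iff_separated Cons.prems a ys by blast
  show ?case
  proof (cases "xs = []")
    case True
    then have "path_edges (x # ys') = {}" using e by (simp add: path_edges_Cons)
    then show ?thesis using True a ys by (auto simp: path_edges_Cons split: if_splits)
  next
    case False
    then have ne: "ys' \<noteq> []" using e by (auto simp: path_edges_Cons)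
    have x: "x \<notin> set xs" "x \<notin> set ys'"
      using Cons.prems a ys by (auto simp: is_path_iff)
    have "{x, hd xs} \<in> insert {x, hd ys'} (path_edges ys')"
      using e False ne by (auto simp: path_edges_Cons)
    moreover have "{x, hd xs} \<notin> path_edges ys'"
      using x path_edges_subset[of "{x, hd xs}" ys'] by blast
    ultimately have "{x, hd xs} = {x, hd ys'}" by blast
    then have h: "hd xs = hd ys'" by (auto simp: doubleton_eq_iff)
    have "is_path E xs (hd xs) y" "is_path E ys' (hd xs) y"
      using Cons.prems a ys False ne h by (auto simp: is_path_iff path_edges_Cons)
    then show ?thesis using Cons.IH a ys by blast
  qed
qed (simp add: is_path_def)

lemma tree_path_eq: "is_path E xs x y \<Longrightarrow> tree_path E x y = xs"
  unfolding tree_path_def using path_unique by blast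

lemma is_path_tree_path: "x \<in> V \<Longrightarrow> y \<in> V \<Longrightarrow> is_path E (tree_path E x y) x y"
  using tree_path_exists tree_path_eq by metis

lemma tree_path_edges_iff:
  "x \<in> V \<Longrightarrow> y \<in> V \<Longrightarrow> f \<in> path_edges (tree_path E x y) \<longleftrightarrow> f \<in> E \<and> separated E f x y"
  using path_edges_iff_separated is_path_tree_path by blast

text \<open>A path from \<open>x\<close> to \<open>u\<close> either avoids the edge or has reached
  one of its ends just before using it.\<close>

lemma not_separated_endpoint:
  assumes e: "{u, v} \<in> E" and x: "x \<in> V"
  shows "\<not> separated E {u, v} x u \<or> \<not> separated E {u, v} x v"
proof -
  have "u \<in> V" using edge_subset[OF e] by simp
  then obtain xs where xs: "is_path E xs x u" using tree_path_exists x by blast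
  show ?thesis
  proof (cases "{u, v} \<in> path_edges xs")
    case True
    then obtain ys zs where s: "xs = ys @ zs" "ys \<noteq> []" "zs \<noteq> []" "{u, v} = {last ys, hd zs}"
      using path_edges_split by metis
    then have "\<not> separated E {u, v} x (last ys)"
      using path_split_not_separated(1) xs by metis
    then show ?thesis using s(4) by (metis doubleton_eq_iff)
  next
    case False
    then have "\<not> separated E {u, v} x u" by (rule not_separated_pathI[OF xs])
    then show ?thesis ..
  qed
qed

text \<open>Deleting an edge of a tree leaves exactly two sides, so two vertices are separated iff
  exactly one of them is on the other side from the reference vertex \<open>z\<close>.\<close>

lemma separated_parity:
  assumes "e \<in> E" "x \<in> V" "y \<in> V" "z \<in> V"
  shows "separated E e x y \<longleftrightarrow> (separated E e z x \<noteq> separated E e z y)"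
proof -
  obtain u v where e: "e = {u, v}" using edge_card[OF assms(1)] by (auto simp: card_2_iff)
  have "\<And>w. w \<in> V \<Longrightarrow> \<not> separated E e w u \<or> \<not> separated E e w v"
    using not_separated_endpoint e assms(1) by blast
  then show ?thesis
    using assms(2-4) separated_triangle[of E e] separated_sym[of E e] by metis
qed

lemma separating_edge_exists:
  assumes "x \<in> V" "y \<in> V" "x \<noteq> y"
  obtains e where "e \<in> E" "separated E e x y"
proof -
  obtain xs where xs: "is_path E xs x y" using tree_path_exists assms by blast
  then obtain ys where ys: "xs = x # ys" by (cases xs) (auto simp: is_path_iff)
  have "ys \<noteq> []" using xs ys assms(3) by (auto simp: is_path_iff)
  then have "{x, hd ys} \<in> path_edges xs" by (simp add: ys path_edges_Cons)
  then show ?thesis using that path_edges_iff_separated[OF xs] by blast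
qed

text \<open>Every path from \<open>z\<close> to \<open>w\<close> uses the edge
  \<open>{x, y}\<close>, including one that avoids \<open>e\<close>; its part up to \<open>x\<close>
  shows the claim, or else its part from \<open>x\<close> on to \<open>w\<close>.\<close>

lemma not_separated_via:
  assumes g: "{x, y} \<in> E" "separated E {x, y} z w" and zw: "\<not> separated E e z w"
  shows "\<not> separated E e z x"
proof -
  obtain ps where ps: "is_path (E - {e}) ps z w" using zw by (auto simp: separated_def)
  then have "is_path E ps z w" by (auto simp: is_path_iff)
  then have "{x, y} \<in> path_edges ps" using path_edges_iff_separated g by blast
  then obtain as bs where s: "ps = as @ bs" "as \<noteq> []" "bs \<noteq> []" "{x, y} = {last as, hd bs}"
    using path_edges_split by metis
  then have "\<not> separated E e z (last as)" "\<not> separated E e (hd bs) w"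
    using ps by (auto simp: is_path_append separated_def)
  moreover have "x = last as \<or> x = hd bs" using s(4) by (auto simp: doubleton_eq_iff)
  ultimately show ?thesis
    using zw separated_triangle[of E e z x w] separated_sym[of E e x w] by (metis separated_triangle)
qed

text \<open>A vertex \<open>x\<close> fulfilling the most prescriptions fulfils all. If
  \<open>e\<close> failed at \<open>x\<close>, consider the first edge \<open>g\<close> of the path
  towards a vertex \<open>z\<close> at which \<open>e\<close> holds: crossing \<open>g\<close> would
  be an improvement, unless \<open>e\<close> and \<open>g\<close> were incompatible.\<close>

lemma tree_helly:
  assumes r: "r \<in> V"
    and pairwise: "\<And>e e'. e \<in> E \<Longrightarrow> e' \<in> E \<Longrightarrow>
      \<exists>x\<in>V. (separated E e r x \<longleftrightarrow> N e) \<and> (separated E e' r x \<longleftrightarrow> N e')"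
  shows "\<exists>x\<in>V. \<forall>e\<in>E. separated E e r x \<longleftrightarrow> N e"
proof -
  define good where "good x = {e \<in> E. separated E e r x \<longleftrightarrow> N e}" for x
  have fin: "finite (good x)" for x
    using finite_E by (simp add: good_def)
  obtain x where x: "x \<in> V" and max: "\<And>y. y \<in> V \<Longrightarrow> card (good y) \<le> card (good x)"
  proof -
    have "finite ((\<lambda>x. card (good x)) ` V)" "(\<lambda>x. card (good x)) ` V \<noteq> {}"
      using finite_V r by auto
    from Max_in[OF this] Max_ge[OF this(1)] show ?thesis using that by fastforce
  qed
  have "e \<in> good x" if e: "e \<in> E" for e
  proof (rule ccontr)
    assume bad: "e \<notin> good x"
    obtain z where z: "z \<in> V" "separated E e r z \<longleftrightarrow> N e" using pairwise e by blast
    have xz: "separated E e x z"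
      using separated_parity[OF e x z(1) r] z bad e by (auto simp: good_def)
    obtain xs where xs: "is_path E xs x z" using tree_path_exists x z by blast
    then obtain ys where ys: "xs = x # ys" by (cases xs) (auto simp: is_path_iff)
    have "ys \<noteq> []" using xs ys xz by (auto simp: is_path_iff)
    define y where "y = hd ys"
    define g where "g = {x, y}"
    have "g \<in> path_edges xs" using \<open>ys \<noteq> []\<close> by (simp add: ys path_edges_Cons y_def g_def)
    then have g: "g \<in> E" "separated E g x z" using path_edges_iff_separated[OF xs] by auto
    have y: "y \<in> V" using edge_subset g by (auto simp: g_def)
    show False
    proof (cases "g \<in> good x")
      \<comment> \<open>A common witness \<open>w\<close> for \<open>e\<close> and \<open>g\<close>
        lies on the side of \<open>x\<close> for \<open>g\<close> and on the side of
        \<open>z\<close> for \<open>e\<close>. A connection from \<open>z\<close> to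
        \<open>w\<close> that avoids \<open>e\<close> must then pass through \<open>x\<close>,
        contradicting that \<open>e\<close> separates \<open>x\<close> from
        \<open>z\<close>.\<close>
      case True
      obtain w where w: "w \<in> V" "separated E e r w \<longleftrightarrow> N e" "separated E g r w \<longleftrightarrow> N g"
        using pairwise[OF e g(1)] by blast
      have xw: "separated E e x w"
        using separated_parity[OF e x w(1) r] w bad e by (auto simp: good_def)
      have "\<not> separated E e z w"
        using separated_parity[OF e z(1) w(1) x] xz xw by blast
      moreover have "\<not> separated E g x w"
        using separated_parity[OF g(1) x w(1) r] w True by (auto simp: good_def)
      then have "separated E g z w"
        using separated_parity[OF g(1) z(1) w(1) x] g by blast
      ultimately have "\<not> separated E e z x"
        using not_separated_via g(1) unfolding g_def by blast
      then show False using xz separated_sym by metis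
    next
      \<comment> \<open>Moving from \<open>x\<close> to \<open>y\<close> changes the side of no edge
        but \<open>g\<close>, so \<open>y\<close> gains \<open>g\<close> and loses nothing.\<close>
      case False
      have "e' \<in> good y" if "e' \<in> good x" for e'
      proof -
        have e': "e' \<in> E" "e' \<noteq> g" using that False by (auto simp: good_def)
        then have "\<not> separated E e' x y" using not_separated_edge[of x y E e'] g unfolding g_def by blast
        then show ?thesis
          using separated_parity[OF e'(1) x y r] that by (auto simp: good_def)
      qed
      moreover have "g \<in> good y"
      proof -
        have "separated E g x y" using edge_separates g by (simp add: g_def)
        then show ?thesis
          using separated_parity[OF g(1) x y r] False g(1) by (auto simp: good_def)
      qed
      ultimately have "good x \<subset> good y" using False by blast
      then have "card (good x) < card (good y)" using fin psubset_card_mono by blast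
      then show False using max[OF y] by simp
    qed
  qed
  then show ?thesis using x by (auto simp: good_def)
qed

end

section \<open>Edge boundaries, tree loads and minimal cuts\<close>

definition boundary :: "'a set \<Rightarrow> 'a set set" where
  "boundary S = {f. f \<inter> S \<noteq> {} \<and> \<not> f \<subseteq> S}"

lemma boundary_edge [simp]: "{u, v} \<in> boundary S \<longleftrightarrow> (u \<in> S) \<noteq> (v \<in> S)"
  by (auto simp: boundary_def)

text \<open>The hypothesis forbids entering \<open>S\<close> from outside, so the path can only
  leave \<open>S\<close>, and at most once.\<close>

lemma card_boundary_path_le_1:
  assumes "\<And>as bs. xs = as @ bs \<Longrightarrow> as \<noteq> [] \<Longrightarrow> bs \<noteq> [] \<Longrightarrow> hd bs \<in> S \<Longrightarrow> last as \<in> S"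
  shows "card (path_edges xs \<inter> boundary S) \<le> 1"
proof -
  \<comment> \<open>The induction also needs that a list starting outside \<open>S\<close> never
    meets it.\<close>
  have "(xs \<noteq> [] \<longrightarrow> hd xs \<notin> S \<longrightarrow> set xs \<inter> S = {}) \<and> card (path_edges xs \<inter> boundary S) \<le> 1"
    using assms
  proof (induction xs)
    case (Cons x ys)
    show ?case
    proof (cases "ys = []")
      case False
      have "last as \<in> S" if "ys = as @ bs" "as \<noteq> []" "bs \<noteq> []" "hd bs \<in> S" for as bs
        using Cons.prems[of "x # as" bs] that by auto
      then have IH: "hd ys \<notin> S \<longrightarrow> set ys \<inter> S = {}" "card (path_edges ys \<inter> boundary S) \<le> 1"
        using Cons.IH False by blast+
      have step: "hd ys \<in> S \<Longrightarrow> x \<in> S"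
        using Cons.prems[of "[x]" ys] False by auto
      have edges: "path_edges (x # ys) = insert {x, hd ys} (path_edges ys)"
        using False by (simp add: path_edges_Cons)
      show ?thesis
      proof (cases "hd ys \<in> S")
        case True
        then have "path_edges (x # ys) \<inter> boundary S = path_edges ys \<inter> boundary S"
          using step edges by auto
        then show ?thesis using IH step True by auto
      next
        case out: False
        then have "path_edges ys \<inter> boundary S = {}"
          using IH(1) path_edges_subset by (fastforce simp: boundary_def)
        then have "path_edges (x # ys) \<inter> boundary S \<subseteq> {{x, hd ys}}"
          using edges by auto
        then have "card (path_edges (x # ys) \<inter> boundary S) \<le> card {{x, hd ys}}"
          by (intro card_mono) auto
        then show ?thesis using IH out by auto
      qed
    qed (auto simp: path_edges_Cons)
  qed simp
  then show ?thesis ..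
qed

definition cut_capacity :: "'a set set \<Rightarrow> ('a set \<Rightarrow> real) \<Rightarrow> 'a set \<Rightarrow> real" where
  "cut_capacity E b S = sum b (E \<inter> boundary S)"

definition crosses :: "'a set set \<Rightarrow> 'a set \<Rightarrow> 'a set \<Rightarrow> bool" where
  "crosses E f p \<longleftrightarrow> (\<exists>i j. p = {i, j} \<and> f \<in> path_edges (tree_path E i j))"

lemma finite_upairs: "finite W \<Longrightarrow> finite (upairs W)"
  by (rule finite_subset[of _ "Pow W"]) (auto simp: upairs_def)

lemma tree_load_eq:
  assumes "finite W"
  shows "tree_load E W D f = (\<Sum>p\<in>upairs W. if crosses E f p then D p else 0)"
  unfolding tree_load_def crosses_def[symmetric]
  using finite_upairs[OF assms] by (rule sum.inter_filter)

lemma tree_load_add: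
  "tree_load E W (\<lambda>p. D p + D' p) f = tree_load E W D f + tree_load E W D' f"
  by (simp add: tree_load_def sum.distrib)

lemma tree_load_cmult: "tree_load E W (\<lambda>p. c * D p) f = c * tree_load E W D f"
  by (simp add: tree_load_def sum_distrib_left)

lemma tree_load_unit:
  assumes "finite W" "q \<in> upairs W"
  shows "tree_load E W (\<lambda>p. of_bool (p = q)) f = of_bool (crosses E f q)"
proof -
  have "tree_load E W (\<lambda>p. of_bool (p = q)) f =
      (\<Sum>p\<in>upairs W. if p = q then of_bool (crosses E f q) else 0)"
    unfolding tree_load_eq[OF assms(1)] by (rule sum.cong) auto
  then show ?thesis using assms finite_upairs[OF assms(1)] by simp
qed

definition cross_pairs :: "'a set \<Rightarrow> 'a set \<Rightarrow> 'a set set" where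
  "cross_pairs A B = {{i, j} | i j. i \<in> A \<and> j \<in> B}"

definition separating_set :: "'a set \<Rightarrow> 'a set \<Rightarrow> 'a set \<Rightarrow> 'a set \<Rightarrow> bool" where
  "separating_set V W A S \<longleftrightarrow> S \<subseteq> V \<and> A \<subseteq> S \<and> S \<inter> (W - A) = {}"

text \<open>The minimum is lexicographic. Breaking ties by cardinality singles out the
  inclusion-smallest minimum cut, as uncrossing shows, while existence only needs two minimisations
  over a finite family.\<close>

definition minimal_cut ::
  "'a set \<Rightarrow> 'a set \<Rightarrow> 'a set set \<Rightarrow> ('a set \<Rightarrow> real) \<Rightarrow> 'a set \<Rightarrow> 'a set \<Rightarrow> bool" where
  "minimal_cut V W E b A S \<longleftrightarrow> separating_set V W A S \<and>
     (\<forall>S'. separating_set V W A S' \<longrightarrow> cut_capacity E b S < cut_capacity E b S' \<or>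
        cut_capacity E b S = cut_capacity E b S' \<and> card S \<le> card S')"

lemma minimal_cutD:
  assumes "minimal_cut V W E b A S"
  shows "separating_set V W A S"
    and "separating_set V W A S' \<Longrightarrow> cut_capacity E b S < cut_capacity E b S' \<or>
      cut_capacity E b S = cut_capacity E b S' \<and> card S \<le> card S'"
  using assms unfolding minimal_cut_def by blast+

section \<open>The universe of demands: compactness and attained maxima\<close>

context
  fixes V W :: "'a set" and E :: "'a set set" and b :: "'a set \<Rightarrow> real"
  assumes tree: "is_tree V E" and WV: "W \<subseteq> V" and b: "\<forall>f\<in>E. b f \<ge> 0"
begin

lemma finite_W: "finite W"
  using finite_V[OF tree] WV finite_subset by blast

lemma finite_pairs: "finite (upairs W)"
  using finite_W by (rule finite_upairs)

lemma crosses_iff: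
  assumes "i \<in> V" "j \<in> V"
  shows "crosses E f {i, j} \<longleftrightarrow> f \<in> E \<and> separated E f i j"
  unfolding crosses_def
  using tree_path_edges_iff[OF tree assms] tree_path_edges_iff[OF tree assms(2,1)]
    separated_sym[of E f i j]
  by (metis doubleton_eq_iff)

lemma zero_in_universe: "(\<lambda>p. 0) \<in> universe E W b"
  using b by (simp add: universe_def tree_load_def)

text \<open>The path joining two distinct leaves has an edge, whose capacity bounds the demand. The
  cruder bound \<open>sum b E\<close> is the same for all pairs and so serves for a box.\<close>

lemma universe_le:
  assumes D: "D \<in> universe E W b" and p: "p \<in> upairs W"
  shows "D p \<le> sum b E"
proof -
  obtain i j where ij: "p = {i, j}" "i \<in> V" "j \<in> V" "i \<noteq> j"
    using p WV by (auto simp: upairs_def)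
  obtain f where f: "f \<in> E" "separated E f i j"
    using separating_edge_exists[OF tree ij(2-4)] by blast
  then have c: "crosses E f p" using ij crosses_iff by blast
  have "D p = (if crosses E f p then D p else 0)" using c by simp
  also have "\<dots> \<le> tree_load E W D f"
    unfolding tree_load_eq[OF finite_W]
    by (rule member_le_sum[OF p _ finite_pairs]) (use D in \<open>auto simp: universe_def\<close>)
  also have "\<dots> \<le> b f" using D f by (auto simp: universe_def)
  also have "\<dots> \<le> sum b E"
    using f b finite_E[OF tree] by (intro member_le_sum) auto
  finally show ?thesis .
qed

text \<open>A closed subset of a product of compact intervals. Coordinates that are not pairs of
  \<open>W\<close> are pinned to \<open>{0}\<close>, so the product over all sets is compact in the
  function space.\<close>

lemma compact_universe: "compact (universe E W b)"
proof -
  let ?B = "PiE UNIV (\<lambda>p. if p \<in> upairs W then {0..sum b E} else {0})"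
  have "compactin (product_topology (\<lambda>i. euclidean) UNIV) ?B"
    unfolding compactin_PiE by (auto simp: compactin_euclidean_iff)
  then have "compact ?B"
    unfolding euclidean_product_topology compactin_euclidean_iff .
  moreover have "universe E W b \<subseteq> ?B"
    using universe_le by (auto simp: universe_def)
  moreover have "closed (universe E W b)"
  proof -
    have "universe E W b = (\<Inter>p\<in>upairs W. {D. 0 \<le> D p}) \<inter> (\<Inter>p\<in>- upairs W. {D. D p = 0})
        \<inter> (\<Inter>f\<in>E. {D. tree_load E W D f \<le> b f})"
      by (auto simp: universe_def)
    also have "closed \<dots>"
      unfolding tree_load_def
      by (intro closed_Int closed_INT ballI closed_Collect_le closed_Collect_eq continuous_intros
          continuous_on_product_coordinates)
    finally show ?thesis .
  qed
  ultimately show ?thesis by (metis compact_Int_closed inf.absorb_iff2)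
qed

lemma universe_maximum:
  "\<exists>D\<in>universe E W b. \<forall>D'\<in>universe E W b. sum D' Q \<le> sum D Q"
proof (rule continuous_attains_sup[OF compact_universe])
  show "universe E W b \<noteq> {}" using zero_in_universe by blast
  show "continuous_on (universe E W b) (\<lambda>D. sum D Q)"
    by (rule continuous_on_subset[OF _ subset_UNIV])
      (intro continuous_intros continuous_on_product_coordinates)
qed

text \<open>The attained maximum supplies the upper bound without which a supremum of reals says
  nothing.\<close>

lemma sum_le_universe_SUP:
  assumes "D \<in> universe E W b"
  shows "sum D Q \<le> (SUP D\<in>universe E W b. sum D Q)"
proof -
  obtain D0 where "\<forall>D'\<in>universe E W b. sum D' Q \<le> sum D0 Q" using universe_maximum by blast
  then have "bdd_above ((\<lambda>D. sum D Q) ` universe E W b)" by (auto intro: bdd_aboveI)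
  then show ?thesis using assms by (rule cSUP_upper2) simp
qed

lemma beta_le: "f \<in> E \<Longrightarrow> beta E W b f \<le> b f"
  unfolding beta_def using zero_in_universe
  by (intro cSUP_least) (auto simp: universe_def)

section \<open>Uncrossing of minimum cuts\<close>

lemma cut_capacity_eq:
  "cut_capacity E b S = (\<Sum>f\<in>E. if f \<in> boundary S then b f else 0)"
  unfolding cut_capacity_def using finite_E[OF tree] by (simp add: sum.inter_restrict)

text \<open>As capacities are nonnegative, it suffices to compare contributions edge by edge.
  Submodularity and posimodularity thereby become truth tables for the ends \<open>u\<close> and
  \<open>v\<close>.\<close>

lemma cut_capacity_uncross:
  assumes "\<And>u v. of_bool ((u \<in> X) \<noteq> (v \<in> X)) + of_bool ((u \<in> Y) \<noteq> (v \<in> Y))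
    \<le> (of_bool ((u \<in> S) \<noteq> (v \<in> S)) + of_bool ((u \<in> T) \<noteq> (v \<in> T)) :: real)"
  shows "cut_capacity E b X + cut_capacity E b Y \<le> cut_capacity E b S + cut_capacity E b T"
  unfolding cut_capacity_eq sum.distrib[symmetric]
proof (rule sum_mono)
  fix f assume f: "f \<in> E"
  obtain u v where uv: "f = {u, v}" using edge_card[OF tree f] by (auto simp: card_2_iff)
  have eq: "(if f \<in> boundary Z then b f else 0) = b f * of_bool ((u \<in> Z) \<noteq> (v \<in> Z))" for Z
    by (simp add: uv)
  have "b f * (of_bool ((u \<in> X) \<noteq> (v \<in> X)) + of_bool ((u \<in> Y) \<noteq> (v \<in> Y)))
    \<le> b f * (of_bool ((u \<in> S) \<noteq> (v \<in> S)) + of_bool ((u \<in> T) \<noteq> (v \<in> T)))"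
    by (rule mult_left_mono[OF assms]) (use b f in blast)
  then show "(if f \<in> boundary X then b f else 0) + (if f \<in> boundary Y then b f else 0)
    \<le> (if f \<in> boundary S then b f else 0) + (if f \<in> boundary T then b f else 0)"
    unfolding eq distrib_left[symmetric] .
qed

lemma minimal_cut_exists:
  assumes "A \<subseteq> W"
  shows "\<exists>S. minimal_cut V W E b A S"
proof -
  let ?F = "{S. separating_set V W A S}"
  have fin: "finite ?F"
    by (rule finite_subset[of _ "Pow V"]) (auto simp: separating_set_def finite_V[OF tree])
  have ne: "?F \<noteq> {}" using assms WV by (auto simp: separating_set_def)
  obtain S0 where S0: "S0 \<in> ?F" "\<And>S. S \<in> ?F \<Longrightarrow> cut_capacity E b S0 \<le> cut_capacity E b S"
    using ex_is_arg_min_if_finite[OF fin ne, of "cut_capacity E b"]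
    by (auto simp: is_arg_min_linorder)
  let ?G = "{S \<in> ?F. cut_capacity E b S = cut_capacity E b S0}"
  have "finite ?G" "?G \<noteq> {}" using fin S0 by auto
  then obtain S where "S \<in> ?G" "\<And>S'. S' \<in> ?G \<Longrightarrow> card S \<le> card S'"
    using ex_is_arg_min_if_finite[of ?G card] by (auto simp: is_arg_min_linorder)
  then have "minimal_cut V W E b A S"
    using S0(2) unfolding minimal_cut_def by force
  then show ?thesis ..
qed

text \<open>Submodularity: \<open>S \<inter> S'\<close> competes with \<open>S\<close> and
  \<open>S \<union> S'\<close> with \<open>S'\<close>. Neither can be cheaper, so both tie, and the
  cardinality condition on \<open>S\<close> forces \<open>S \<inter> S' = S\<close>.\<close>

lemma minimal_cut_subset:
  assumes S: "minimal_cut V W E b A S" and S': "minimal_cut V W E b A' S'" and A: "A \<subseteq> A'"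
  shows "S \<subseteq> S'"
proof -
  have "cut_capacity E b (S \<inter> S') + cut_capacity E b (S \<union> S')
      \<le> cut_capacity E b S + cut_capacity E b S'"
  proof (rule cut_capacity_uncross)
    show "of_bool ((u \<in> S \<inter> S') \<noteq> (v \<in> S \<inter> S')) + of_bool ((u \<in> S \<union> S') \<noteq> (v \<in> S \<union> S'))
      \<le> (of_bool ((u \<in> S) \<noteq> (v \<in> S)) + of_bool ((u \<in> S') \<noteq> (v \<in> S')) :: real)" for u v
      by (cases "u \<in> S"; cases "v \<in> S"; cases "u \<in> S'"; cases "v \<in> S'") simp_all
  qed
  moreover have "separating_set V W A (S \<inter> S')" "separating_set V W A' (S \<union> S')"
    using minimal_cutD(1)[OF S] minimal_cutD(1)[OF S'] A unfolding separating_set_def by blast+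
  note minimal_cutD(2)[OF S this(1)] minimal_cutD(2)[OF S' this(2)]
  ultimately have "card S \<le> card (S \<inter> S')" by linarith
  moreover have "finite S"
    using minimal_cutD(1)[OF S] finite_V[OF tree] finite_subset by (auto simp: separating_set_def)
  ultimately have "S \<inter> S' = S" by (intro card_seteq) auto
  then show ?thesis by blast
qed

text \<open>Posimodularity: \<open>S - S'\<close> and \<open>S' - S\<close> are still separating
  because \<open>A\<close> and \<open>A'\<close> are disjoint. They tie with \<open>S\<close> and
  \<open>S'\<close>, and the cardinality condition gives \<open>S - S' = S\<close>.\<close>

lemma minimal_cut_disjoint:
  assumes S: "minimal_cut V W E b A S" and S': "minimal_cut V W E b A' S'"
    and A: "A \<subseteq> W" "A' \<subseteq> W" "A \<inter> A' = {}"
  shows "S \<inter> S' = {}"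
proof -
  have "cut_capacity E b (S - S') + cut_capacity E b (S' - S)
      \<le> cut_capacity E b S + cut_capacity E b S'"
  proof (rule cut_capacity_uncross)
    show "of_bool ((u \<in> S - S') \<noteq> (v \<in> S - S')) + of_bool ((u \<in> S' - S) \<noteq> (v \<in> S' - S))
      \<le> (of_bool ((u \<in> S) \<noteq> (v \<in> S)) + of_bool ((u \<in> S') \<noteq> (v \<in> S')) :: real)" for u v
      by (cases "u \<in> S"; cases "v \<in> S"; cases "u \<in> S'"; cases "v \<in> S'") simp_all
  qed
  moreover have "separating_set V W A (S - S')" "separating_set V W A' (S' - S)"
    using minimal_cutD(1)[OF S] minimal_cutD(1)[OF S'] A unfolding separating_set_def by blast+
  note minimal_cutD(2)[OF S this(1)] minimal_cutD(2)[OF S' this(2)]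
  ultimately have "card S \<le> card (S - S')" by linarith
  moreover have "finite S"
    using minimal_cutD(1)[OF S] finite_V[OF tree] finite_subset by (auto simp: separating_set_def)
  ultimately have "S - S' = S" by (intro card_seteq) auto
  then show ?thesis by blast
qed

section \<open>Max-flow min-cut for demands on a tree\<close>

text \<open>For demands of maximum total between \<open>A\<close> and \<open>W - A\<close>, a cut
  \<open>S\<close> is found whose boundary edges are all saturated and are crossed at most once by
  each positive demand. Its capacity is then at most that total.\<close>

lemma cut_capacity_le_flow:
  assumes AW: "A \<subseteq> W"
  shows "\<exists>D\<in>universe E W b. \<exists>S. separating_set V W A S \<and>
     cut_capacity E b S \<le> sum D (cross_pairs A (W - A))"
proof -
  define Q where "Q = cross_pairs A (W - A)"
  note finW = finite_W and finP = finite_pairs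
  have QP: "Q \<subseteq> upairs W" using AW by (auto simp: Q_def cross_pairs_def upairs_def)
  have finQ: "finite Q" using QP finP finite_subset by blast
  have Q: "{i, j} \<in> Q" if "i \<in> A" "j \<in> W - A" for i j
    using that by (auto simp: Q_def cross_pairs_def)
  obtain D0 where D0: "D0 \<in> universe E W b"
    "\<And>D'. D' \<in> universe E W b \<Longrightarrow> sum D' Q \<le> sum D0 Q"
    using universe_maximum by blast
  \<comment> \<open>Dropping the demands outside \<open>Q\<close> keeps feasibility and the
    objective, and leaves only demands from \<open>A\<close> to \<open>W - A\<close> to load the
    edges.\<close>
  define D where "D p = (if p \<in> Q then D0 p else 0)" for p
  have D_le: "tree_load E W D f \<le> tree_load E W D0 f" for f
    unfolding tree_load_def using D0(1) by (intro sum_mono) (auto simp: D_def universe_def)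
  have DU: "D \<in> universe E W b"
  proof -
    have "tree_load E W D f \<le> b f" if "f \<in> E" for f
      using D_le[of f] D0(1) that by (fastforce simp: universe_def)
    then show ?thesis using D0(1) QP by (auto simp: universe_def D_def)
  qed
  have opt: "sum D' Q \<le> sum D Q" if "D' \<in> universe E W b" for D'
    using D0(2)[OF that] by (simp add: D_def)
  have D_nonneg: "0 \<le> D p" for p using DU by (cases "p \<in> upairs W") (auto simp: universe_def)
  have D_out: "D p = 0" if "p \<notin> Q" for p using that by (simp add: D_def)
  have load_le: "tree_load E W D f \<le> b f" if "f \<in> E" for f
    using DU that by (simp add: universe_def)

  (* aug d a v: moving D a little in the direction d leaves the total flow from A to the other
     leaves unchanged and makes room for additional flow from a to v. The set S of vertices v
     admitting such a and d plays the role of the residual-reachable vertices of max-flow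
     min-cut; working with directions instead of flows avoids any flow decomposition. *)
  define aug where "aug d a v \<longleftrightarrow>
      a \<in> A \<and> (\<forall>p. p \<notin> Q \<longrightarrow> d p = 0) \<and> (\<forall>p. D p = 0 \<longrightarrow> 0 \<le> d p) \<and>
      sum d Q = 0 \<and> (\<forall>f\<in>E. tree_load E W D f = b f \<longrightarrow>
        tree_load E W d f + of_bool (separated E f a v) \<le> 0)" for d :: "'a set \<Rightarrow> real" and a v
  define S where "S = {v \<in> V. \<exists>d a. aug d a v}"
  have load_unit: "tree_load E W (\<lambda>p. d p + of_bool (p = {i, j})) f =
      tree_load E W d f + of_bool (separated E f i j)"
    if "f \<in> E" "i \<in> A" "j \<in> W - A" for d f i j
  proof -
    have ij: "i \<in> V" "j \<in> V" "{i, j} \<in> upairs W" using that AW WV Q QP by auto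
    show ?thesis
      using tree_load_unit[OF finW ij(3), where E = E and f = f]
        crosses_iff[OF ij(1,2)] that(1)
      by (simp add: tree_load_add)
  qed
  have sum_unit: "(\<Sum>p\<in>Q. d p + of_bool (p = {i, j})) = sum d Q + 1"
    if "i \<in> A" "j \<in> W - A" for d :: "'a set \<Rightarrow> real" and i j
    using Q[OF that] finQ by (simp add: sum.distrib of_bool_def)

  have sep: "separating_set V W A S"
  proof -
    \<comment> \<open>Room from \<open>a\<close> to itself costs nothing, so the zero direction
      suffices.\<close>
    have "aug (\<lambda>p. 0) a a" if "a \<in> A" for a
      using that by (auto simp: aug_def tree_load_def)
    then have "A \<subseteq> S" using AW WV by (auto simp: S_def)
    moreover have False if y: "y \<in> S" "y \<in> W - A" for y
    proof -
      obtain d a where da: "aug d a y" using y by (auto simp: S_def)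
      then have a: "a \<in> A" by (simp add: aug_def)
      \<comment> \<open>Filling the room with one unit from \<open>a\<close> to the leaf
        \<open>y\<close> gives a direction that stays feasible for small steps but raises the total,
        contradicting optimality.\<close>
      define d' where "d' p = d p + of_bool (p = {a, y})" for p
      have d'_nonneg: "0 \<le> d' p" if "D p = 0" for p
        using da that by (simp add: d'_def aug_def)
      have d'_load: "tree_load E W d' f \<le> 0" if "f \<in> E" "tree_load E W D f = b f" for f
        using load_unit[OF that(1) a y(2), of d] da that unfolding d'_def aug_def by auto
      \<comment> \<open>Constraints with slack survive small steps, and \<open>d'\<close> respects
        those without. As there are finitely many of each, one positive \<open>t\<close> serves
        all.\<close>
      have ev_pos: "\<forall>\<^sub>F t in at_right 0. 0 < x + t * z" if "0 < x" for x z :: real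
      proof (rule order_tendstoD(1)[OF _ that])
        show "((\<lambda>t. x + t * z) \<longlongrightarrow> x) (at_right 0)"
          by (rule tendsto_eq_intros refl | simp)+
      qed
      have "\<forall>\<^sub>F t in at_right 0. \<forall>p\<in>upairs W. 0 \<le> D p + t * d' p"
      proof (rule eventually_ball_finite[OF finP], rule ballI)
        fix p
        show "\<forall>\<^sub>F t in at_right 0. 0 \<le> D p + t * d' p"
        proof (cases "D p = 0")
          case True
          show ?thesis
            using eventually_at_right_less[of 0]
            by eventually_elim (use True d'_nonneg[of p] in simp)
        next
          case False
          then have "0 < D p" using D_nonneg[of p] by simp
          from ev_pos[OF this, of "d' p"] show ?thesis by eventually_elim simp
        qed
      qed
      moreover have "\<forall>\<^sub>F t in at_right 0. \<forall>f\<in>E. tree_load E W D f + t * tree_load E W d' f \<le> b f"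
      proof (rule eventually_ball_finite[OF finite_E[OF tree]], rule ballI)
        fix f assume f: "f \<in> E"
        show "\<forall>\<^sub>F t in at_right 0. tree_load E W D f + t * tree_load E W d' f \<le> b f"
        proof (cases "tree_load E W D f = b f")
          case True
          show ?thesis
            using eventually_at_right_less[of 0]
            by eventually_elim (use True d'_load[OF f] in \<open>simp add: mult_nonneg_nonpos\<close>)
        next
          case False
          then have "0 < b f - tree_load E W D f" using load_le[OF f] by simp
          from ev_pos[OF this, of "- tree_load E W d' f"] show ?thesis by eventually_elim simp
        qed
      qed
      ultimately have "\<forall>\<^sub>F t in at_right 0. 0 < t \<and> (\<forall>p\<in>upairs W. 0 \<le> D p + t * d' p) \<and>
          (\<forall>f\<in>E. tree_load E W D f + t * tree_load E W d' f \<le> b f)"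
        using eventually_at_right_less[of 0] by eventually_elim simp
      then obtain t :: real where t: "0 < t" "\<forall>p\<in>upairs W. 0 \<le> D p + t * d' p"
          "\<forall>f\<in>E. tree_load E W D f + t * tree_load E W d' f \<le> b f"
        using eventually_happens' trivial_limit_at_right_real by blast
      have d'_out: "d' p = 0" if "p \<notin> Q" for p
        using that da Q[OF a y(2)] by (auto simp: d'_def aug_def)
      have "D p + t * d' p = 0" if "p \<notin> upairs W" for p
      proof -
        have "p \<notin> Q" using QP that by blast
        then show ?thesis by (simp add: D_out d'_out)
      qed
      then have "(\<lambda>p. D p + t * d' p) \<in> universe E W b"
        using t by (simp add: universe_def tree_load_add tree_load_cmult)
      then have "(\<Sum>p\<in>Q. D p + t * d' p) \<le> sum D Q" by (rule opt)
      moreover have "sum d' Q = 1"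
        using sum_unit[OF a y(2), of d] da by (simp add: d'_def aug_def)
      ultimately show False
        using t(1) by (simp add: sum.distrib sum_distrib_left[symmetric])
    qed
    ultimately show ?thesis by (auto simp: separating_set_def S_def)
  qed
  have SV: "S \<subseteq> V" by (auto simp: S_def)

  \<comment> \<open>An edge with slack does not constrain \<open>aug\<close>, and all other edges
    have \<open>u\<close> and \<open>v\<close> on the same side. The direction witnessing
    \<open>u\<close> would therefore witness \<open>v\<close> as well.\<close>
  have tight: "tree_load E W D f = b f" if f: "f \<in> E" "f = {u, v}" "u \<in> S" "v \<notin> S" for f u v
  proof (rule ccontr)
    assume slack: "tree_load E W D f \<noteq> b f"
    obtain d a where da: "aug d a u" using f by (auto simp: S_def)
    have vV: "v \<in> V" using edge_subset[OF tree f(1)] f by simp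
    have same: "separated E g a v \<longleftrightarrow> separated E g a u" if "g \<noteq> f" for g
      using not_separated_edge[of u v E g] f that separated_triangle[of E g a v u]
        separated_triangle[of E g a u v] separated_sym[of E g u v] by blast
    have "tree_load E W d g + of_bool (separated E g a v) \<le> 0"
      if g: "g \<in> E" "tree_load E W D g = b g" for g
    proof -
      have "g \<noteq> f" using g(2) slack by blast
      then show ?thesis using same[of g] da g by (simp add: aug_def)
    qed
    then have "aug d a v" using da by (simp add: aug_def)
    then show False using vV f by (auto simp: S_def)
  qed

  (* Rerouting along a residual arc: a demand from i to j passing from v to u is replaced by one
     from a to j, so that the room created for a at u becomes room for i at v. *)
  have no_entry: "v \<in> S"
    if e: "{v, u} \<in> E" "u \<in> S" and D: "D {i, j} > 0" and ij: "i \<in> A" "j \<in> W - A"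
      and iv: "\<not> separated E {v, u} i v" and uj: "\<not> separated E {v, u} u j" for u v i j
  proof -
    obtain d a where da: "aug d a u" using e by (auto simp: S_def)
    then have a: "a \<in> A" by (simp add: aug_def)
    have inV: "a \<in> V" "i \<in> V" "j \<in> V" "u \<in> V" "v \<in> V"
      using a ij AW WV edge_subset[OF tree e(1)] by auto
    \<comment> \<open>Through \<open>d1\<close>, both changes are additions of one unit:
      \<open>{a, j}\<close> to \<open>d\<close> and \<open>{i, j}\<close> to \<open>d'\<close>. So
      \<open>load_unit\<close> and \<open>sum_unit\<close> cover the removal too.\<close>
    define d1 where "d1 p = d p + of_bool (p = {a, j})" for p
    define d' where "d' p = d1 p - of_bool (p = {i, j})" for p
    have d1_eq: "d1 = (\<lambda>p. d' p + of_bool (p = {i, j}))" by (auto simp: d'_def)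
    have sep_ij: "separated E {v, u} i j"
      using edge_separates[OF tree e(1)] iv uj separated_triangle[of E "{v, u}" v u i]
        separated_triangle[of E "{v, u}" i u j] separated_sym[of E "{v, u}"] by blast
    \<comment> \<open>On \<open>{v, u}\<close> itself the demand from \<open>i\<close> to
      \<open>j\<close> pays for everything. Any other edge has \<open>u\<close> and \<open>v\<close>
      on one side, and if it separates \<open>i\<close> from \<open>v\<close> it also separates
      \<open>i\<close> from \<open>j\<close>, as \<open>v\<close> is on their path; parity does the
      rest.\<close>
    have key: "of_bool (separated E f a j) + of_bool (separated E f i v)
        \<le> (of_bool (separated E f i j) + of_bool (separated E f a u) :: real)" if f: "f \<in> E" for f
    proof (cases "f = {v, u}")
      case True
      then show ?thesis using iv sep_ij by simp
    next
      case False
      have 1: "\<not> separated E f u v"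
        using not_separated_edge[OF e(1)] False separated_sym[of E f u v] by blast
      have 2: "\<not> separated E f i j \<Longrightarrow> \<not> separated E f i v"
        using not_separated_via[OF tree e(1) sep_ij] by blast
      show ?thesis
        using 1 2 separated_parity[OF tree f inV(2,3,1)] separated_parity[OF tree f inV(2,5,1)]
          separated_parity[OF tree f inV(4,5,1)] by auto
    qed
    have "tree_load E W d' f + of_bool (separated E f i v) \<le> 0"
      if f: "f \<in> E" "tree_load E W D f = b f" for f
    proof -
      have "tree_load E W d1 f = tree_load E W d f + of_bool (separated E f a j)"
        unfolding d1_def by (rule load_unit[OF f(1) a ij(2)])
      moreover have "tree_load E W d1 f = tree_load E W d' f + of_bool (separated E f i j)"
        unfolding d1_eq by (rule load_unit[OF f(1) ij])
      moreover have "tree_load E W d f + of_bool (separated E f a u) \<le> 0"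
        using da f by (simp add: aug_def)
      ultimately show ?thesis using key[OF f(1)] by linarith
    qed
    moreover have "sum d' Q = 0"
    proof -
      have "sum d1 Q = sum d Q + 1" unfolding d1_def by (rule sum_unit[OF a ij(2)])
      moreover have "sum d1 Q = sum d' Q + 1" unfolding d1_eq by (rule sum_unit[OF ij])
      ultimately show ?thesis using da by (simp add: aug_def)
    qed
    moreover have "d' p = 0" if "p \<notin> Q" for p
      using that da Q[OF a ij(2)] Q[OF ij] by (auto simp: d'_def d1_def aug_def)
    \<comment> \<open>The only coordinate lowered from \<open>d1\<close> is \<open>{i, j}\<close>,
      where \<open>D\<close> is positive.\<close>
    moreover have "0 \<le> d' p" if "D p = 0" for p
      using that da D by (cases "p = {i, j}") (auto simp: d'_def d1_def aug_def)
    ultimately have "aug d' i v" using ij by (simp add: aug_def)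
    then show ?thesis using inV by (auto simp: S_def)
  qed

  \<comment> \<open>By \<open>no_entry\<close>, the path of a positive demand, followed from its end
    in \<open>A\<close>, never enters \<open>S\<close>.\<close>
  have once: "card {f \<in> E \<inter> boundary S. crosses E f p} \<le> 1" if p: "p \<in> Q" "D p > 0" for p
  proof -
    obtain i j where ij: "p = {i, j}" "i \<in> A" "j \<in> W - A"
      using p(1) by (auto simp: Q_def cross_pairs_def)
    then have V: "i \<in> V" "j \<in> V" using AW WV by auto
    let ?xs = "tree_path E i j"
    have xs: "is_path E ?xs i j" using is_path_tree_path[OF tree V] .
    have "card (path_edges ?xs \<inter> boundary S) \<le> 1"
    proof (rule card_boundary_path_le_1)
      fix as bs assume s: "?xs = as @ bs" "as \<noteq> []" "bs \<noteq> []" and "hd bs \<in> S"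
      have "is_path E (as @ bs) i j" using xs s by simp
      from path_split_not_separated[OF this s(2,3)] this show "last as \<in> S"
        using no_entry[of "last as" "hd bs" i j] p ij s \<open>hd bs \<in> S\<close>
        by (auto simp: is_path_append)
    qed
    moreover have "{f \<in> E \<inter> boundary S. crosses E f p} = path_edges ?xs \<inter> boundary S"
      using crosses_iff[OF V] tree_path_edges_iff[OF tree V] ij by blast
    ultimately show ?thesis by simp
  qed

  let ?C = "E \<inter> boundary S"
  have finC: "finite ?C" using finite_E[OF tree] by simp
  \<comment> \<open>Double counting: capacities on the boundary equal loads, and swapping the sums
    weights each demand by the number of boundary edges on its path.\<close>
  have "cut_capacity E b S = (\<Sum>f\<in>?C. tree_load E W D f)"
    unfolding cut_capacity_def
  proof (rule sum.cong)
    fix f assume f: "f \<in> ?C"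
    then obtain u v where uv: "f = {u, v}" using edge_card[OF tree] by (metis IntD1 card_2_iff)
    then have "u \<in> S \<and> v \<notin> S \<or> v \<in> S \<and> u \<notin> S" using f by auto
    then show "b f = tree_load E W D f"
      using tight[of f u v] tight[of f v u] f uv by (auto simp: insert_commute)
  qed simp
  also have "\<dots> = (\<Sum>p\<in>upairs W. \<Sum>f\<in>?C. if crosses E f p then D p else 0)"
    unfolding tree_load_eq[OF finW] by (rule sum.swap)
  also have "\<dots> = (\<Sum>p\<in>upairs W. D p * card {f \<in> ?C. crosses E f p})"
    using finC by (simp add: sum.inter_filter[symmetric] mult.commute)
  also have "\<dots> \<le> sum D (upairs W)"
  proof (rule sum_mono)
    fix p
    show "D p * card {f \<in> ?C. crosses E f p} \<le> D p"
    proof (cases "D p > 0")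
      case True
      then have "p \<in> Q" using D_out by force
      then show ?thesis using once True by (simp add: mult_le_cancel_left1)
    qed (use D_nonneg[of p] in simp)
  qed
  also have "\<dots> = sum D Q"
    using QP finP D_out by (intro sum.mono_neutral_right) auto
  finally show ?thesis using DU sep unfolding Q_def by blast
qed

end

section \<open>Construction of the hubbing\<close>

theorem theorem3:
  fixes VF VT W :: "'a set" and EF ET :: "'a set set" and b :: "'a set \<Rightarrow> real"
  assumes "is_tree VF EF" and "leaves VF EF = W"
    and "is_tree VT ET" and "leaves VT ET = W"
    and "\<forall>f\<in>ET. b f \<ge> 0"
  shows "\<exists>phiV phiE. T_hubbing VT ET b VF EF W phiV phiE (qstar EF W ET b)"
proof -
  note F = assms(1) and T = assms(3) and b = assms(5)
  have WF: "W \<subseteq> VF" and WT: "W \<subseteq> VT" using assms by (auto simp: leaves_def)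
  obtain r where r: "r \<in> VF" using F by (auto simp: is_tree_def)
  define A where "A e = {i \<in> W. separated EF e r i}" for e
  have "\<exists>S. minimal_cut VT W ET b (A e) S" for e
    using minimal_cut_exists[OF T WT b, of "A e"] by (auto simp: A_def)
  then obtain S where S: "\<And>e. minimal_cut VT W ET b (A e) (S e)" by metis
  then have sepS: "separating_set VT W (A e) (S e)" for e
    using minimal_cutD(1) by blast
  have AS: "i \<in> S e \<longleftrightarrow> separated EF e r i" if "i \<in> W" for i e
    using sepS[of e] that by (auto simp: separating_set_def A_def)

  \<comment> \<open>Two prescriptions are always met together by a leaf or by the root: a leaf of
    \<open>A e \<inter> A e'\<close> if both are positive, a leaf of the difference if one is, and
    \<open>r\<close> if neither is. Any \<open>v\<close> is allowed, so \<open>phiV\<close> can be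
    chosen as a total function.\<close>
  have "\<exists>x\<in>VF. \<forall>e\<in>EF. separated EF e r x \<longleftrightarrow> v \<in> S e" for v
  proof (rule tree_helly[OF F r])
    fix e e'
    have subset: "v \<in> S e2" if "A e1 \<subseteq> A e2" "v \<in> S e1" for e1 e2
      using minimal_cut_subset[OF T WT b S S that(1)] that(2) by blast
    have meet: "A e \<inter> A e' \<noteq> {}" if "v \<in> S e" "v \<in> S e'"
      using minimal_cut_disjoint[OF T WT b S S, of e e'] that by (auto simp: A_def)
    consider "v \<in> S e" "v \<in> S e'" | "v \<in> S e" "v \<notin> S e'" | "v \<notin> S e" "v \<in> S e'"
      | "v \<notin> S e" "v \<notin> S e'" by blast
    then show "\<exists>x\<in>VF. (separated EF e r x \<longleftrightarrow> v \<in> S e) \<and> (separated EF e' r x \<longleftrightarrow> v \<in> S e')"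
    proof cases
      case 1
      then show ?thesis using meet WF by (fastforce simp: A_def)
    next
      case 2
      then have "\<not> A e \<subseteq> A e'" using subset by blast
      then show ?thesis using 2 WF by (fastforce simp: A_def)
    next
      case 3
      then have "\<not> A e' \<subseteq> A e" using subset by blast
      then show ?thesis using 3 WF by (fastforce simp: A_def)
    next
      case 4
      then show ?thesis by (intro bexI[OF _ r]) simp
    qed
  qed
  then obtain phiV where phi: "\<And>v. phiV v \<in> VF"
    "\<And>v e. e \<in> EF \<Longrightarrow> separated EF e r (phiV v) \<longleftrightarrow> v \<in> S e"
    by metis
  \<comment> \<open>A leaf \<open>i\<close> itself fulfils the prescriptions for \<open>i\<close>,
    so no edge separates it from \<open>phiV i\<close>.\<close>
  have phi_leaf: "phiV i = i" if i: "i \<in> W" for i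
  proof (rule ccontr)
    assume "phiV i \<noteq> i"
    then obtain e where e: "e \<in> EF" "separated EF e (phiV i) i"
      using separating_edge_exists[OF F phi(1)] i WF by blast
    then show False
      using separated_parity[OF F e(1) phi(1) _ r] phi(2) AS i WF by blast
  qed

  \<comment> \<open>An edge is an unordered pair, so an orientation has to be chosen. Which one is
    immaterial, since an embedding may map the edge to a path in either direction.\<close>
  define phiE where "phiE f = (let (v, w) = SOME (v, w). f = {v, w} in
      tree_path EF (phiV v) (phiV w))" for f
  have phiE: "\<exists>v' w'. {v, w} = {v', w'} \<and> phiE {v, w} = tree_path EF (phiV v') (phiV w')" for v w
  proof -
    obtain v' w' where vw: "(SOME (v', w'). {v, w} = {v', w'}) = (v', w')" by fastforce
    have "case (SOME (v', w'). {v, w} = {v', w'}) of (v', w') \<Rightarrow> {v, w} = {v', w'}"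
      by (rule someI[of _ "(v, w)"]) simp
    then show ?thesis using vw by (auto simp: phiE_def)
  qed
  have embedding: "T_embedding VT ET VF EF W phiV phiE"
    unfolding T_embedding_def
  proof (intro conjI allI impI)
    fix v w
    obtain v' w' where "{v, w} = {v', w'}" "phiE {v, w} = tree_path EF (phiV v') (phiV w')"
      using phiE by blast
    then show "is_path EF (phiE {v, w}) (phiV v) (phiV w) \<or>
        is_path EF (phiE {v, w}) (phiV w) (phiV v)"
      using is_path_tree_path[OF F phi(1) phi(1)] by (metis doubleton_eq_iff)
  qed (use phi(1) phi_leaf in auto)

  \<comment> \<open>By parity, \<open>e\<close> lies on the image path iff exactly one end of
    \<open>f\<close> is in \<open>S e\<close>.\<close>
  have path_iff: "e \<in> path_edges (phiE f) \<longleftrightarrow> f \<in> boundary (S e)" if e: "e \<in> EF" and f: "f \<in> ET"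
    for e f
  proof -
    obtain v w where "f = {v, w}" using edge_card[OF T f] by (auto simp: card_2_iff)
    then obtain v' w' where vw: "f = {v', w'}" "phiE f = tree_path EF (phiV v') (phiV w')"
      using phiE by metis
    then show ?thesis
      using tree_path_edges_iff[OF F phi(1) phi(1), of e v' w'] e
        separated_parity[OF F e phi(1) phi(1) r, of v' w'] phi(2)[OF e] by simp
  qed

  have "0 \<le> qstar EF W ET b e \<and>
      (\<Sum>f\<in>{f \<in> ET. e \<in> path_edges (phiE f)}. beta ET W b f) \<le> qstar EF W ET b e" if e: "e \<in> EF" for e
  proof -
    have "A e \<subseteq> W" by (auto simp: A_def)
    then obtain D X where DX: "D \<in> universe ET W b" "separating_set VT W (A e) X"
        "cut_capacity ET b X \<le> sum D (cross_pairs (A e) (W - A e))"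
      using cut_capacity_le_flow[OF T WT b] by blast
    \<comment> \<open>The pairs separated by \<open>e\<close> are those with exactly one member on
      the far side from \<open>r\<close>.\<close>
    have Delta: "Delta EF W e = cross_pairs (A e) (W - A e)"
    proof (rule set_eqI)
      fix p
      have sep: "separated EF e i j \<longleftrightarrow> (i \<in> A e) \<noteq> (j \<in> A e)" if "i \<in> W" "j \<in> W" for i j
        using separated_parity[OF F e _ _ r, of i j] that WF by (auto simp: A_def)
      show "p \<in> Delta EF W e \<longleftrightarrow> p \<in> cross_pairs (A e) (W - A e)"
      proof
        assume "p \<in> Delta EF W e"
        then obtain i j where ij: "p = {i, j}" "separated EF e i j" "p \<in> upairs W"
          by (auto simp: Delta_def)
        then have "i \<in> W" "j \<in> W" by (auto simp: upairs_def doubleton_eq_iff)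
        then show "p \<in> cross_pairs (A e) (W - A e)"
          using sep ij by (auto simp: cross_pairs_def insert_commute)
      next
        assume "p \<in> cross_pairs (A e) (W - A e)"
        then obtain i j where ij: "p = {i, j}" "i \<in> A e" "j \<in> W - A e"
          by (auto simp: cross_pairs_def)
        then have "i \<in> W" "j \<in> W" "i \<noteq> j" by (auto simp: A_def)
        then show "p \<in> Delta EF W e"
          using sep ij unfolding Delta_def upairs_def by blast
      qed
    qed
    have "(\<Sum>f\<in>{f \<in> ET. e \<in> path_edges (phiE f)}. beta ET W b f) \<le> cut_capacity ET b (S e)"
    proof -
      have "{f \<in> ET. e \<in> path_edges (phiE f)} = ET \<inter> boundary (S e)" using path_iff[OF e] by blast
      then show ?thesis
        unfolding cut_capacity_def using beta_le[OF T WT b] by (auto intro: sum_mono)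
    qed
    moreover have "0 \<le> cut_capacity ET b (S e)"
      unfolding cut_capacity_def using b by (intro sum_nonneg) auto
    \<comment> \<open>The cut \<open>X\<close> matched by the demands need not be
      \<open>S e\<close>, but \<open>S e\<close> has minimum capacity.\<close>
    moreover have "cut_capacity ET b (S e) \<le> cut_capacity ET b X"
      using minimal_cutD(2)[OF S DX(2)] by linarith
    moreover have "sum D (Delta EF W e) \<le> qstar EF W ET b e"
      unfolding qstar_def by (rule sum_le_universe_SUP[OF T WT b DX(1)])
    ultimately show ?thesis using DX(3) Delta by simp
  qed
  then show ?thesis using embedding unfolding T_hubbing_def by blast
qed

end
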